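(* Let $n,m$ be integers with $m\le n$, and let $\mathcal{G}(n,m)$ be the class of triples $(X,E,B)$ where $(X,E)$ is a finite connected undirected simple graph, $B\subset X$, $|X|=n$, $|B|=m$, and $\deg_E(b)=1$ for every $b\in B$. Let $T=(\bar X,\bar E,\bar B)\in\mathcal{G}(n,m)$ be such that $(\bar X,\bar E)$ is a tree and $\bar B$ is the set of all leaves of this tree. Let $G=(X,E,B)\in\mathcal{G}(n,m)$ be arbitrary (not assumed to be a tree). If there is a bijection $\phi:B\to\bar B$ such that $d(b_1,b_2)=\bar d(\phi(b_1),\phi(b_2))$ for all $b_1,b_2\in B$, where $d$ and $\bar d$ denote the graph distance functions of $(X,E)$ and $(\bar X,\bar E)$ respectively, then $G$ is isomorphic to $T$ (i.e., $(X,E)$ and $(\bar X,\bar E)$ are isomorphic graphs).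
   Context: The graph distance $d_{(X,E)}(x,y)$ is the minimal number of edges in a path connecting $x$ and $y$ (every edge has length 1). $\deg_E(v)$ is the number of edges incident to $v$. A leaf of a tree is a vertex of degree $1$. Vertices of $X\setminus B$ are allowed to have degree $1$ in members of $\mathcal{G}(n,m)$. *)

theory Defs
  imports Main
begin

text \<open>
  An undirected simple graph is a vertex set together with a set of two-element sets of vertices.
  The AFP entry Graph_Theory encodes undirected graphs as symmetric digraphs; its notion of tree
  is not usable for them, since every pair of opposite arcs counts as a cycle there.
\<close>

definition simple_graph :: "'a set \<Rightarrow> 'a set set \<Rightarrow> bool" where
  "simple_graph X E \<longleftrightarrow> (\<forall>e\<in>E. e \<subseteq> X \<and> card e = 2)"

definition degree :: "'a set set \<Rightarrow> 'a \<Rightarrow> nat" where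
  "degree E v = card {e \<in> E. v \<in> e}"

definition path_between :: "'a set \<Rightarrow> 'a set set \<Rightarrow> 'a \<Rightarrow> 'a list \<Rightarrow> 'a \<Rightarrow> bool" where
  "path_between X E x p y \<longleftrightarrow>
     p \<noteq> [] \<and> hd p = x \<and> last p = y \<and> set p \<subseteq> X \<and> distinct p \<and>
     successively (\<lambda>u v. {u, v} \<in> E) p"

text \<open>The empty graph counts as connected.\<close>

definition connected_graph :: "'a set \<Rightarrow> 'a set set \<Rightarrow> bool" where
  "connected_graph X E \<longleftrightarrow> (\<forall>x\<in>X. \<forall>y\<in>X. \<exists>p. path_between X E x p y)"

text \<open>A path is a list of vertices, so it has one edge less than its length.
  The value is unspecified if there is no path.\<close>

definition graph_dist :: "'a set \<Rightarrow> 'a set set \<Rightarrow> 'a \<Rightarrow> 'a \<Rightarrow> nat" where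
  "graph_dist X E x y = (LEAST k. \<exists>p. path_between X E x p y \<and> k = length p - 1)"

definition is_cycle :: "'a set \<Rightarrow> 'a set set \<Rightarrow> 'a list \<Rightarrow> bool" where
  "is_cycle X E c \<longleftrightarrow>
     length c \<ge> 3 \<and> set c \<subseteq> X \<and> distinct c \<and>
     successively (\<lambda>u v. {u, v} \<in> E) c \<and> {last c, hd c} \<in> E"

definition is_tree :: "'a set \<Rightarrow> 'a set set \<Rightarrow> bool" where
  "is_tree X E \<longleftrightarrow> simple_graph X E \<and> connected_graph X E \<and> (\<nexists>c. is_cycle X E c)"

definition leaves :: "'a set \<Rightarrow> 'a set set \<Rightarrow> 'a set" where
  "leaves X E = {v \<in> X. degree E v = 1}"

definition graph_isomorphic :: "'a set \<Rightarrow> 'a set set \<Rightarrow> 'b set \<Rightarrow> 'b set set \<Rightarrow> bool" where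
  "graph_isomorphic X E Y F \<longleftrightarrow>
     (\<exists>f. bij_betw f X Y \<and> (\<forall>u\<in>X. \<forall>v\<in>X. {u, v} \<in> E \<longleftrightarrow> {f u, f v} \<in> F))"

definition boundary_graphs :: "nat \<Rightarrow> nat \<Rightarrow> ('a set \<times> 'a set set \<times> 'a set) set" where
  "boundary_graphs n m =
     {(X, E, B). finite X \<and> simple_graph X E \<and> connected_graph X E \<and> B \<subseteq> X \<and>
        card X = n \<and> card B = m \<and> (\<forall>b\<in>B. degree E b = 1)}"

end

theory Submission
  imports Defs
begin

text \<open>
  Balls in a tree have the Helly property, so every vertex \<open>x\<close> of \<open>G\<close> has a counterpart \<open>f x\<close> in the tree
  with \<open>d'(f x, \<phi> b) \<le> d(x, b)\<close> for all boundary vertices \<open>b\<close>. Geodesics of \<open>G\<close> between boundary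
  vertices must then be mapped exactly onto the tree paths between the corresponding leaves. These paths
  cover all vertices and edges of the tree, so \<open>f\<close> is onto, hence bijective since both graphs have \<open>n\<close>
  vertices, and every edge of the tree comes from an edge of \<open>G\<close>. A further edge of \<open>G\<close> would join
  vertices that are at distance at least 2 in the tree and thus shorten the distance between two leaves.
\<close>

section \<open>Walks, paths and upper bounds on distances\<close>

text \<open>Dropping \<open>distinct\<close> makes the notion closed under concatenation.\<close>

definition walk_between :: "'a set \<Rightarrow> 'a set set \<Rightarrow> 'a \<Rightarrow> 'a list \<Rightarrow> 'a \<Rightarrow> bool" where
  "walk_between X E x p y \<longleftrightarrow>
     p \<noteq> [] \<and> hd p = x \<and> last p = y \<and> set p \<subseteq> X \<and> successively (\<lambda>u v. {u, v} \<in> E) p"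

lemma path_between_iff_walk: "path_between X E x p y \<longleftrightarrow> walk_between X E x p y \<and> distinct p"
  unfolding path_between_def walk_between_def by blast

lemma successively_append_Cons_iff:
  "successively P (xs @ v # ys) \<longleftrightarrow> successively P (xs @ [v]) \<and> successively P (v # ys)"
  by (auto simp: successively_append_iff)

lemma walk_between_join:
  assumes "walk_between X E x p y" and "walk_between X E y q z"
  shows "walk_between X E x (p @ tl q) z"
proof (cases q)
  case Nil
  then show ?thesis using assms(2) by (simp add: walk_between_def)
next
  case (Cons a q')
  then show ?thesis
    using assms by (cases q') (auto simp: walk_between_def successively_append_iff)
qed

lemma walk_between_rev:
  assumes "walk_between X E x p y"
  shows "walk_between X E y (rev p) x"
  using assms by (auto simp: walk_between_def hd_rev last_rev insert_commute)

text \<open>Cutting out the closed detour between two occurrences of a vertex shortens a walk;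
  repeated cuts end in a path.\<close>

lemma walk_between_imp_path:
  assumes "walk_between X E x p y"
  shows "\<exists>q. path_between X E x q y \<and> length q \<le> length p"
  using assms
proof (induction "length p" arbitrary: p rule: less_induct)
  case less
  show ?case
  proof (cases "distinct p")
    case True
    then show ?thesis using less.prems by (auto simp: path_between_iff_walk)
  next
    case False
    then obtain us v vs ws where p: "p = us @ [v] @ vs @ [v] @ ws"
      using not_distinct_decomp by blast
    have "successively (\<lambda>u v. {u, v} \<in> E) (us @ [v])"
      "successively (\<lambda>u v. {u, v} \<in> E) (v # ws)"
      using less.prems successively_append_Cons_iff[of "\<lambda>u v. {u, v} \<in> E" us v "vs @ v # ws"]
        successively_append_Cons_iff[of "\<lambda>u v. {u, v} \<in> E" "us @ v # vs" v ws]
      by (simp_all add: walk_between_def p)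
    then have "walk_between X E x (us @ [v] @ ws) y"
      using less.prems successively_append_Cons_iff[of _ us v ws]
      by (auto simp: walk_between_def p hd_append)
    from less.hyps[OF _ this] obtain q
      where "path_between X E x q y" "length q \<le> length (us @ [v] @ ws)"
      by (auto simp: p)
    then show ?thesis by (auto simp: p intro!: exI[of _ q])
  qed
qed

text \<open>Allows distances to be bounded by walks, although \<open>graph_dist\<close> minimises
  over paths only.\<close>

lemma graph_dist_le_walk:
  assumes "walk_between X E x p y"
  shows "graph_dist X E x y \<le> length p - 1"
proof -
  obtain q where q: "path_between X E x q y" "length q \<le> length p"
    using walk_between_imp_path[OF assms] by blast
  have "graph_dist X E x y \<le> length q - 1"
    unfolding graph_dist_def by (rule Least_le) (use q in blast)
  then show ?thesis using q by linarith
qed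

text \<open>Both pieces keep the vertex \<open>p ! i\<close>, so they have \<open>i\<close> and
  \<open>length p - 1 - i\<close> edges.\<close>

lemma walk_between_nth:
  assumes "walk_between X E x p y" and "i < length p"
  shows "walk_between X E x (take (Suc i) p) (p ! i)" "walk_between X E (p ! i) (drop i p) y"
proof -
  have s: "successively (\<lambda>u v. {u, v} \<in> E) (take (Suc i) p @ drop (Suc i) p)"
    "successively (\<lambda>u v. {u, v} \<in> E) (take i p @ drop i p)"
    using assms by (simp_all only: append_take_drop_id walk_between_def)
  show "walk_between X E x (take (Suc i) p) (p ! i)"
    using assms s(1) set_take_subset[of "Suc i" p] unfolding successively_append_iff
    by (auto simp: walk_between_def take_Suc_conv_app_nth hd_append hd_conv_nth)
  show "walk_between X E (p ! i) (drop i p) y"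
    using assms s(2) set_drop_subset[of i p] unfolding successively_append_iff
    by (auto simp: walk_between_def hd_drop_conv_nth)
qed

section \<open>The metric of a connected graph\<close>

locale connected_simple_graph =
  fixes X :: "'a set" and E :: "'a set set"
  assumes simple: "simple_graph X E" and connected: "connected_graph X E"
begin

abbreviation dist :: "'a \<Rightarrow> 'a \<Rightarrow> nat" where
  "dist \<equiv> graph_dist X E"

lemma edgeD:
  assumes "{u, v} \<in> E"
  shows "u \<in> X" "v \<in> X" "u \<noteq> v"
  using assms simple by (auto simp: simple_graph_def card_2_iff doubleton_eq_iff)

text \<open>Connectedness makes the set under \<open>LEAST\<close> nonempty, so the minimum is
  attained; \<open>Suc\<close> converts edges to vertices.\<close>

lemma geodesic:
  assumes "x \<in> X" "y \<in> X"
  obtains p where "path_between X E x p y" "length p = Suc (dist x y)"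
proof -
  have "\<exists>k p. path_between X E x p y \<and> k = length p - 1"
    using connected assms by (auto simp: connected_graph_def)
  from LeastI_ex[OF this] obtain p
    where "path_between X E x p y" "dist x y = length p - 1"
    unfolding graph_dist_def by blast
  then show thesis using that[of p] by (cases p) (auto simp: path_between_def)
qed

lemma geodesic_walk:
  assumes "x \<in> X" "y \<in> X"
  obtains p where "walk_between X E x p y" "length p = Suc (dist x y)"
  using geodesic[OF assms] path_between_iff_walk by metis

lemma dist_self: "x \<in> X \<Longrightarrow> dist x x = 0"
  using graph_dist_le_walk[of X E x "[x]" x] by (simp add: walk_between_def)

lemma dist_eq_0:
  assumes "x \<in> X" "y \<in> X" "dist x y = 0"
  shows "x = y"
proof -
  obtain p where "walk_between X E x p y" "length p = 1"
    using geodesic_walk[OF assms(1,2)] assms(3) by auto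
  then show ?thesis by (auto simp: walk_between_def length_Suc_conv)
qed

lemma dist_le_1:
  assumes "x \<in> X" "y \<in> X" "x \<noteq> y" "dist x y \<le> 1"
  shows "{x, y} \<in> E"
proof -
  have "dist x y = 1" using assms dist_eq_0 by (cases "dist x y") auto
  then obtain p where p: "walk_between X E x p y" "length p = Suc (Suc 0)"
    using geodesic_walk[OF assms(1,2)] by (metis One_nat_def)
  then obtain u v where "p = [u, v]" by (auto simp: length_Suc_conv)
  with p(1) show ?thesis by (auto simp: walk_between_def)
qed

lemma dist_edge:
  assumes "{u, v} \<in> E"
  shows "dist u v \<le> 1"
  using graph_dist_le_walk[of X E u "[u, v]" v] edgeD[OF assms] assms by (simp add: walk_between_def)

lemma dist_triangle:
  assumes "x \<in> X" "y \<in> X" "z \<in> X"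
  shows "dist x z \<le> dist x y + dist y z"
proof -
  obtain p q where p: "walk_between X E x p y" "length p = Suc (dist x y)"
    and q: "walk_between X E y q z" "length q = Suc (dist y z)"
    using geodesic_walk assms by metis
  show ?thesis using graph_dist_le_walk[OF walk_between_join[OF p(1) q(1)]] p q by simp
qed

lemma dist_commute:
  assumes "x \<in> X" "y \<in> X"
  shows "dist x y = dist y x"
proof -
  have "dist a b \<le> dist b a" if "a \<in> X" "b \<in> X" for a b
  proof -
    obtain p where "walk_between X E b p a" "length p = Suc (dist b a)"
      using geodesic_walk \<open>a \<in> X\<close> \<open>b \<in> X\<close> by metis
    then show ?thesis using graph_dist_le_walk[OF walk_between_rev] by fastforce
  qed
  then show ?thesis using assms by (simp add: le_antisym)
qed

lemma ex_neighbour: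
  assumes "u \<in> X" "v \<in> X" "u \<noteq> v"
  shows "\<exists>w. {u, w} \<in> E"
proof -
  obtain p where p: "walk_between X E u p v" using geodesic_walk[OF assms(1,2)] by blast
  then obtain q where q: "p = u # q" by (cases p) (auto simp: walk_between_def)
  with p assms(3) have "q \<noteq> []" by (auto simp: walk_between_def)
  then have "{u, hd q} \<in> E" using p q by (auto simp: walk_between_def successively_Cons)
  then show ?thesis ..
qed

end

section \<open>Unique paths and betweenness in trees\<close>

locale tree_graph = connected_simple_graph +
  assumes acyclic: "\<nexists>c. is_cycle X E c"
begin

text \<open>Otherwise let \<open>w\<close> be the first vertex of one branch lying on the other:
  going from \<open>x\<close> to \<open>w\<close> along the first branch and back along the second
  is a cycle.\<close>

lemma branches_disjoint:
  assumes "path_between X E x (x # a # p) y" "path_between X E x (x # b # q) z" "a \<noteq> b"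
  shows "set (a # p) \<inter> set (b # q) = {}"
proof (rule ccontr)
  assume "set (a # p) \<inter> set (b # q) \<noteq> {}"
  then have "\<exists>w\<in>set (a # p). w \<in> set (b # q)" by blast
  then obtain p1 w p2 where p: "a # p = p1 @ w # p2" and w: "w \<in> set (b # q)"
    and p1: "\<forall>v\<in>set p1. v \<notin> set (b # q)"
    using split_list_first_prop[of "a # p" "\<lambda>w. w \<in> set (b # q)"] by blast
  from w obtain q1 q2 where q: "b # q = q1 @ w # q2" by (meson split_list)
  let ?c = "x # p1 @ w # rev q1"
  have P: "path_between X E x (x # p1 @ w # p2) y" and Q: "path_between X E x (x # q1 @ w # q2) z"
    using assms(1,2) by (simp_all only: p q)
  have "is_cycle X E ?c"
    unfolding is_cycle_def
  proof (intro conjI)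
    \<comment> \<open>Since \<open>a \<noteq> b\<close>, the vertex \<open>w\<close> cannot directly
      follow \<open>x\<close> on both branches.\<close>
    have "p1 \<noteq> [] \<or> q1 \<noteq> []" using p q assms(3) by (cases p1; cases q1) auto
    then show "3 \<le> length ?c" by (cases p1; cases q1) auto
    show "set ?c \<subseteq> X" using P Q by (auto simp: path_between_def)
    have "set p1 \<inter> set q1 = {}" using p1 by (auto simp: q)
    then show "distinct ?c" using P Q by (auto simp: path_between_def)
    have "successively (\<lambda>u v. {u, v} \<in> E) ((x # p1) @ [w])"
      using P successively_append_Cons_iff[of _ "x # p1" w p2] by (simp add: path_between_def)
    moreover have "successively (\<lambda>u v. {u, v} \<in> E) ((x # q1) @ [w])"
      using Q successively_append_Cons_iff[of _ "x # q1" w q2] by (simp add: path_between_def)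
    then have "successively (\<lambda>u v. {u, v} \<in> E) (rev (q1 @ [w]))"
      unfolding successively_rev by (simp add: insert_commute successively_Cons)
    ultimately show "successively (\<lambda>u v. {u, v} \<in> E) ?c"
      using successively_append_Cons_iff[of _ "x # p1" w "rev q1"] by simp
    \<comment> \<open>The closing edge is \<open>{b, x}\<close>, whether or not \<open>q1\<close> is
      empty.\<close>
    show "{last ?c, hd ?c} \<in> E"
      using Q by (cases q1)
        (auto simp: path_between_def successively_append_iff successively_Cons insert_commute)
  qed
  with acyclic show False by blast
qed

text \<open>Where two paths first diverge they form branches that meet again at
  \<open>y\<close>.\<close>

lemma path_unique:
  assumes "path_between X E x p y" "path_between X E x q y"
  shows "p = q"
  using assms
proof (induction p arbitrary: x q)
  case Nil
  then show ?case by (simp add: path_between_def)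
next
  case (Cons x' p)
  obtain q' where q: "q = x # q'" using Cons.prems(2) by (cases q) (auto simp: path_between_def)
  have x: "x' = x" using Cons.prems(1) by (simp add: path_between_def)
  show ?case
  proof (cases "p = [] \<or> q' = []")
    case True
    then show ?thesis using Cons.prems q x
      by (auto simp: path_between_def split: if_splits)
  next
    case False
    then obtain a p1 b q1 where ab: "p = a # p1" "q' = b # q1" by (meson list.exhaust)
    show ?thesis
    proof (cases "a = b")
      case True
      then have "path_between X E a p y" "path_between X E a q' y"
        using Cons.prems q ab by (auto simp: path_between_def)
      then show ?thesis using Cons.IH q x by blast
    next
      case False
      have "y \<in> set (a # p1)" "y \<in> set (b # q1)"
        using Cons.prems unfolding q ab path_between_def by (metis last_ConsR last_in_set list.distinct(1))+
      then show ?thesis using branches_disjoint[of x a p1 y b q1 y] Cons.prems q x ab False by blast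
    qed
  qed
qed

lemma dist_path:
  assumes "path_between X E x p y"
  shows "dist x y = length p - 1"
proof -
  have "x \<in> X" "y \<in> X" using assms by (auto simp: path_between_def)
  then show ?thesis using geodesic path_unique assms by (metis diff_Suc_1)
qed

lemma dist_path_append:
  assumes "path_between X E x (p @ v # q) y"
  shows "dist x y = dist x v + dist v y"
proof -
  have "path_between X E x (p @ [v]) v" "path_between X E v (v # q) y"
    using assms by (auto simp: path_between_def successively_append_iff hd_append)
  from this[THEN dist_path] dist_path[OF assms] show ?thesis by simp
qed

text \<open>Disjointness of the branches makes one reversed branch followed by the other a path
  through \<open>x\<close>.\<close>

lemma dist_branches:
  assumes "path_between X E x (x # a # p) y" "path_between X E x (x # b # q) z" "a \<noteq> b"
  shows "dist y z = dist y x + dist x z"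
proof -
  have "path_between X E y (rev (a # p) @ x # b # q) z"
    using assms branches_disjoint[OF assms]
    by (auto simp: path_between_def successively_append_iff hd_append hd_rev last_rev insert_commute
        simp del: rev.simps)
  then show ?thesis by (rule dist_path_append)
qed

text \<open>The paths from \<open>y\<close> to \<open>a\<close> and to \<open>b\<close> leave
  \<open>y\<close> by different edges, so the path to \<open>c\<close> differs from one of them in
  its first edge.\<close>

lemma between_or:
  assumes "a \<in> X" "b \<in> X" "c \<in> X" "y \<in> X" and ab: "dist a b = dist a y + dist y b"
  shows "dist a c = dist a y + dist y c \<or> dist b c = dist b y + dist y c"
proof (cases "y = a \<or> y = b \<or> y = c")
  case True
  then show ?thesis using assms dist_self by auto
next
  case False
  obtain p q r where "path_between X E y p a" "path_between X E y q b" "path_between X E y r c"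
    using geodesic assms by metis
  moreover have "\<exists>u p'. p = y # u # p'" if "path_between X E y p z" "y \<noteq> z" for p z
    using that by (cases p; cases "tl p") (auto simp: path_between_def)
  ultimately obtain u p' v q' w r' where P: "path_between X E y (y # u # p') a"
    and Q: "path_between X E y (y # v # q') b" and R: "path_between X E y (y # w # r') c"
    using False by metis
  \<comment> \<open>A common first vertex would be closer than \<open>y\<close> to both
    \<open>a\<close> and \<open>b\<close>, giving a shortcut.\<close>
  have "u \<noteq> v"
  proof
    assume "u = v"
    then have "path_between X E u (u # p') a" "path_between X E u (u # q') b" "u \<in> X"
      using P Q by (auto simp: path_between_def)
    then have "dist u a < dist y a" "dist u b < dist y b"
      using P Q by (auto dest!: dist_path)
    then show False
      using ab dist_triangle[of a u b] dist_commute[of a u] dist_commute[of a y] assms \<open>u \<in> X\<close> by linarith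
  qed
  then have "u \<noteq> w \<or> v \<noteq> w" by blast
  then show ?thesis using dist_branches[OF P R] dist_branches[OF Q R] by blast
qed

text \<open>With \<open>z\<close> as the third point, \<open>between_or\<close> forces
  \<open>dist y z = 0\<close>.\<close>

lemma between_unique:
  assumes "a \<in> X" "b \<in> X" "y \<in> X" "z \<in> X"
    and "dist a b = dist a y + dist y b" "dist a z = dist a y" "dist z b = dist y b"
  shows "y = z"
proof -
  have "dist b z = dist b y" using assms(7) dist_commute[OF assms(2,4)] dist_commute[OF assms(2,3)] by simp
  then have "dist y z = 0" using between_or[OF assms(1,2,4,3,5)] assms(6) by linarith
  then show ?thesis using dist_eq_0 assms by blast
qed

section \<open>Extending paths to leaves\<close>

text \<open>An end that is not a leaf has an edge besides the last edge of the path, which exists as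
  \<open>x \<noteq> y\<close>. Acyclicity keeps the new vertex off the path, and finiteness stops
  the process.\<close>

lemma path_extend_to_leaf:
  assumes "finite X" "path_between X E x p y" "x \<noteq> y"
  shows "\<exists>q b. path_between X E x (p @ q) b \<and> b \<in> leaves X E"
  using assms(2,3)
proof (induction "card X - length p" arbitrary: p y rule: less_induct)
  case less
  show ?case
  proof (cases "y \<in> leaves X E")
    case True
    then show ?thesis using less.prems by (metis append_Nil2)
  next
    case False
    obtain r where "p = r @ [y]"
      using less.prems by (cases p rule: rev_cases) (auto simp: path_between_def)
    moreover then obtain s u where "r = s @ [u]"
      using less.prems by (cases r rule: rev_cases) (auto simp: path_between_def)
    ultimately have p: "p = s @ [u, y]" by simp
    have u: "{u, y} \<in> E" and y: "y \<in> X"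
      using less.prems p by (auto simp: path_between_def successively_append_iff)
    have "{e \<in> E. y \<in> e} \<noteq> {{u, y}}"
    proof
      assume "{e \<in> E. y \<in> e} = {{u, y}}"
      then have "degree E y = 1" unfolding degree_def by simp
      with False y show False by (simp add: leaves_def)
    qed
    moreover have "{u, y} \<in> {e \<in> E. y \<in> e}" using u by simp
    ultimately obtain e where e: "e \<in> E" "y \<in> e" "e \<noteq> {u, y}" by fastforce
    have "card e = 2" using e(1) simple by (simp add: simple_graph_def)
    with e(2) obtain w where "e = {y, w}" unfolding card_2_iff by fastforce
    with e have w: "{y, w} \<in> E" "u \<noteq> w" by (auto simp: insert_commute)
    have "path_between X E y (rev p) x"
      using less.prems(1) walk_between_rev by (auto simp: path_between_iff_walk)
    then have P: "path_between X E y (y # u # rev s) x" by (simp add: p)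
    have W: "path_between X E y [y, w] w"
      using w(1) edgeD[OF w(1)] by (simp add: path_between_def)
    \<comment> \<open>At \<open>y\<close>, the reversed path and the single edge to \<open>w\<close>
      are branches with different first vertices.\<close>
    have "w \<notin> set p"
      using branches_disjoint[OF P W w(2)] edgeD[OF w(1)] p by auto
    then have pw: "path_between X E x (p @ [w]) w"
      using less.prems(1) w(1) edgeD[OF w(1)]
      by (simp add: path_between_def successively_append_iff)
    then have "x \<noteq> w" using p by (cases s) (auto simp: path_between_def)
    have "length (p @ [w]) \<le> card X"
      using pw card_mono[OF \<open>finite X\<close>, of "set (p @ [w])"] distinct_card[of "p @ [w]"]
      by (simp add: path_between_def)
    then have "card X - length (p @ [w]) < card X - length p" by simp
    then obtain q b where "path_between X E x ((p @ [w]) @ q) b" "b \<in> leaves X E"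
      using less.hyps[OF _ pw \<open>x \<noteq> w\<close>] by blast
    then show ?thesis by (metis append_assoc)
  qed
qed

text \<open>The conclusion \<open>u \<noteq> b\<close> permits a second application that starts from
  \<open>b\<close>.\<close>

lemma dist_extend_to_leaf:
  assumes "finite X" "u \<in> X" "v \<in> X" "u \<noteq> v"
  obtains b where "b \<in> leaves X E" "dist u b = dist u v + dist v b" "u \<noteq> b"
proof -
  obtain p where p: "path_between X E u p v" using geodesic assms by metis
  then obtain q b where q: "path_between X E u (p @ q) b" and b: "b \<in> leaves X E"
    using path_extend_to_leaf assms by metis
  obtain r where r: "p = r @ [v]"
    using p by (cases p rule: rev_cases) (auto simp: path_between_def)
  have d: "dist u b = dist u v + dist v b" using dist_path_append[of u r v q b] q r by simp
  moreover have "u \<noteq> b" using d dist_self[of u] dist_eq_0[of u v] assms by auto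
  ultimately show thesis using that b by blast
qed

text \<open>Extend beyond \<open>v\<close> to a leaf \<open>b\<close>, then from \<open>b\<close>
  beyond \<open>u\<close> to a leaf \<open>a\<close>.\<close>

lemma dist_extend_to_leaves:
  assumes "finite X" "u \<in> X" "v \<in> X" "u \<noteq> v"
  obtains a b where "a \<in> leaves X E" "b \<in> leaves X E"
    "dist a b = dist a u + dist u v + dist v b"
proof -
  obtain b where b: "b \<in> leaves X E" "dist u b = dist u v + dist v b" "u \<noteq> b"
    using dist_extend_to_leaf assms by metis
  then have bX: "b \<in> X" by (simp add: leaves_def)
  obtain a where a: "a \<in> leaves X E" "dist b a = dist b u + dist u a"
    using dist_extend_to_leaf[of b u] assms b(3) bX by metis
  then have aX: "a \<in> X" by (simp add: leaves_def)
  show thesis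
    using that[of a b] a b dist_commute[of a b] dist_commute[of u b] dist_commute[of u a] aX bX assms
    by simp
qed

text \<open>Helly property: seen from a root \<open>b0\<close>, the ball whose nearest point is deepest decides, and that
  nearest point lies in all the balls.\<close>

lemma balls_common_point:
  assumes "finite B" "B \<noteq> {}" "B \<subseteq> X"
    and r: "\<And>b c. b \<in> B \<Longrightarrow> c \<in> B \<Longrightarrow> dist b c \<le> r b + r c"
  shows "\<exists>y\<in>X. \<forall>b\<in>B. dist y b \<le> r b"
proof -
  obtain b0 where b0: "b0 \<in> B" using assms by blast
  \<comment> \<open>Depth of the point of the ball around \<open>b\<close> nearest to the root;
    truncated subtraction gives 0 if the ball contains the root.\<close>
  define t where "t b = dist b0 b - r b" for b
  have "Max (t ` B) \<in> t ` B" using assms by (intro Max_in) auto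
  then obtain b where b: "b \<in> B" and "t b = Max (t ` B)" by fastforce
  then have max: "t c \<le> t b" if "c \<in> B" for c using that assms(1) by simp
  have BX: "c \<in> X" if "c \<in> B" for c using that assms by blast
  show ?thesis
  proof (cases "t b = 0")
    \<comment> \<open>All depths vanish, so the root lies in every ball.\<close>
    case True
    then show ?thesis using max b0 BX by (fastforce simp: t_def)
  next
    case False
    obtain p where p: "path_between X E b0 p b" "length p = Suc (dist b0 b)"
      using geodesic b0 b BX by metis
    define y where "y = p ! t b"
    have lt: "t b < length p" using p(2) by (simp add: t_def)
    then have y: "y \<in> X" using p(1) nth_mem by (fastforce simp: y_def path_between_def)
    have w: "walk_between X E b0 p b" using p(1) by (simp add: path_between_iff_walk)
    have "path_between X E b0 (take (Suc (t b)) p) y" "path_between X E y (drop (t b) p) b"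
      using walk_between_nth[OF w lt] p(1) unfolding path_between_iff_walk y_def by auto
    then have d0: "dist b0 y = t b" and d1: "dist y b = dist b0 b - t b"
      using lt p(2) by (auto dest!: dist_path)
    have tb: "t b + r b = dist b0 b" using False by (simp add: t_def)
    have "dist y c \<le> r c" if c: "c \<in> B" for c
    proof -
      \<comment> \<open>If \<open>y\<close> lies between \<open>b0\<close> and \<open>c\<close>,
        maximality of \<open>t b\<close> bounds \<open>dist y c\<close>; if it lies between
        \<open>b\<close> and \<open>c\<close>, the hypothesis on the radii does, as
        \<open>dist b y = r b\<close>.\<close>
      have "dist b0 c = dist b0 y + dist y c \<or> dist b c = dist b y + dist y c"
        using between_or[of b0 b c y] d0 d1 tb b0 b c y BX by simp
      moreover have "t c \<le> t b" "dist b c \<le> r b + r c" using max r b c by auto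
      moreover have "dist b y = r b" using d1 tb dist_commute b y BX by simp
      ultimately show ?thesis using d0 by (auto simp: t_def)
    qed
    then show ?thesis using y by blast
  qed
qed

end

section \<open>Recovering the graph from its boundary distances\<close>

theorem theorem2p1:
  fixes n m :: nat
    and X :: "'a set" and E :: "'a set set" and B :: "'a set"
    and X' :: "'b set" and E' :: "'b set set" and B' :: "'b set"
  assumes "m \<le> n"
    and "(X', E', B') \<in> boundary_graphs n m"
    and "is_tree X' E'"
    and "B' = leaves X' E'"
    and "(X, E, B) \<in> boundary_graphs n m"
    and "\<exists>\<phi>. bij_betw \<phi> B B' \<and>
           (\<forall>b1\<in>B. \<forall>b2\<in>B. graph_dist X E b1 b2 = graph_dist X' E' (\<phi> b1) (\<phi> b2))"
  shows "graph_isomorphic X E X' E'"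
proof -
  have fin: "finite X" "finite X'" and card: "card X = card X'" and BX: "B \<subseteq> X" and BX': "B' \<subseteq> X'"
    using assms by (auto simp: boundary_graphs_def)
  interpret G: connected_simple_graph X E
    using assms by unfold_locales (auto simp: boundary_graphs_def)
  interpret T: tree_graph X' E'
    using assms by unfold_locales (auto simp: is_tree_def)
  obtain \<phi> where \<phi>: "bij_betw \<phi> B B'"
    and iso: "\<And>b c. b \<in> B \<Longrightarrow> c \<in> B \<Longrightarrow> G.dist b c = T.dist (\<phi> b) (\<phi> c)"
    using assms(6) by blast
  have \<phi>X: "\<phi> b \<in> X'" if "b \<in> B" for b using that \<phi> BX' bij_betwE by blast
  show ?thesis
  proof (cases "\<exists>u\<in>X'. \<exists>v\<in>X'. u \<noteq> v")
    \<comment> \<open>With at most one vertex there are no edges, and any bijection is an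
      isomorphism.\<close>
    case False
    obtain f where f: "bij_betw f X X'" using finite_same_card_bij fin card by blast
    then have "{u, v} \<notin> E \<and> {f u, f v} \<notin> E'" if "u \<in> X" "v \<in> X" for u v
    proof -
      have "f u = f v" using False that f bij_betwE by metis
      moreover then have "u = v" using that f by (auto simp: bij_betw_def inj_on_def)
      ultimately show ?thesis using G.edgeD(3) T.edgeD(3) by metis
    qed
    then show ?thesis using f unfolding graph_isomorphic_def by blast
  next
    case True
    have lift: "\<exists>b\<in>B. \<phi> b = b'" if "b' \<in> leaves X' E'" for b'
      using that \<phi> unfolding assms(4)[symmetric] by (auto simp: bij_betw_def)
    have ends: "\<exists>a\<in>B. \<exists>b\<in>B. T.dist (\<phi> a) (\<phi> b) = T.dist (\<phi> a) u + T.dist u v + T.dist v (\<phi> b)"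
      if "u \<in> X'" "v \<in> X'" "u \<noteq> v" for u v
      using T.dist_extend_to_leaves[OF fin(2) that] lift by metis
    have "B \<noteq> {}" using True ends by blast
    have "\<exists>y\<in>X'. \<forall>b\<in>B. T.dist y (\<phi> b) \<le> G.dist x b" if "x \<in> X" for x
    proof -
      \<comment> \<open>The balls are centred at the leaves \<open>\<phi> b\<close> with radius
        \<open>G.dist x b\<close>; the triangle inequality through \<open>x\<close> in
        \<open>G\<close> is the Helly condition.\<close>
      define r where "r c = G.dist x (inv_into B \<phi> c)" for c
      have inv: "inv_into B \<phi> (\<phi> b) = b" if "b \<in> B" for b
        using that \<phi> by (simp add: bij_betw_def)
      have "T.dist b c \<le> r b + r c" if "b \<in> \<phi> ` B" "c \<in> \<phi> ` B" for b c
      proof -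
        from that obtain b1 c1 where bc: "b1 \<in> B" "b = \<phi> b1" "c1 \<in> B" "c = \<phi> c1" by blast
        then have "G.dist b1 c1 \<le> G.dist b1 x + G.dist x c1"
          using G.dist_triangle BX \<open>x \<in> X\<close> by blast
        then show ?thesis using bc iso inv G.dist_commute[of b1 x] BX \<open>x \<in> X\<close> by (auto simp: r_def)
      qed
      then have "\<exists>y\<in>X'. \<forall>b\<in>\<phi> ` B. T.dist y b \<le> r b"
        using T.balls_common_point[of "\<phi> ` B" r] \<open>B \<noteq> {}\<close> \<phi>X finite_subset[OF BX fin(1)] by blast
      then show ?thesis using inv by (auto simp: r_def)
    qed
    then obtain f where fX: "\<And>x. x \<in> X \<Longrightarrow> f x \<in> X'"
      and f: "\<And>x b. x \<in> X \<Longrightarrow> b \<in> B \<Longrightarrow> T.dist (f x) (\<phi> b) \<le> G.dist x b"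
      by metis
    \<comment> \<open>For \<open>x = b\<close> the ball around \<open>\<phi> b\<close> has radius
      0.\<close>
    have f\<phi>: "f b = \<phi> b" if "b \<in> B" for b
      using f[of b b] that G.dist_self[of b] T.dist_eq_0[of "f b" "\<phi> b"] fX \<phi>X BX by auto
    \<comment> \<open>\<open>f\<close> maps a geodesic between boundary points vertex by vertex onto the corresponding path in the tree.\<close>
    have edge_lift: "\<exists>u\<in>X. \<exists>v\<in>X. {u, v} \<in> E \<and> f u = u' \<and> f v = v'" if e: "{u', v'} \<in> E'" for u' v'
    proof -
      note e' = T.edgeD[OF e]
      obtain a b where ab: "a \<in> B" "b \<in> B"
        and "T.dist (\<phi> a) (\<phi> b) = T.dist (\<phi> a) u' + T.dist u' v' + T.dist v' (\<phi> b)"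
        using ends[OF e'] by blast
      moreover have "T.dist u' v' = 1"
        using T.dist_edge[OF e] T.dist_eq_0[OF e'(1,2)] e'(3) by fastforce
      ultimately have L: "T.dist (\<phi> a) (\<phi> b) = Suc (T.dist (\<phi> a) u' + T.dist v' (\<phi> b))" by simp
      define i where "i = T.dist (\<phi> a) u'"
      note ab' = \<phi>X[OF ab(1)] \<phi>X[OF ab(2)]
      have aX: "a \<in> X" "b \<in> X" using ab BX by auto
      obtain p where p: "walk_between X E a p b" "length p = Suc (T.dist (\<phi> a) (\<phi> b))"
        using G.geodesic_walk[OF aX] iso[OF ab] by metis
      \<comment> \<open>The image of \<open>p ! j\<close> is no farther from either leaf than
        \<open>w\<close> is. As \<open>w\<close> lies between the leaves, both bounds are
        equalities, and \<open>between_unique\<close> applies.\<close>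
      have on_path: "p ! j \<in> X \<and> f (p ! j) = w"
        if j: "j = T.dist (\<phi> a) w" and w: "w \<in> X'"
          and l: "T.dist (\<phi> a) (\<phi> b) = T.dist (\<phi> a) w + T.dist w (\<phi> b)" for j w
      proof -
        have lt: "j < length p" using p j l by simp
        then have x: "p ! j \<in> X" using p nth_mem by (fastforce simp: walk_between_def)
        have "G.dist a (p ! j) \<le> j" "G.dist (p ! j) b \<le> T.dist w (\<phi> b)"
          using graph_dist_le_walk[OF walk_between_nth(1)[OF p(1) lt]]
            graph_dist_le_walk[OF walk_between_nth(2)[OF p(1) lt]] lt p(2) l j by simp_all
        then have "T.dist (\<phi> a) (f (p ! j)) \<le> T.dist (\<phi> a) w" "T.dist (f (p ! j)) (\<phi> b) \<le> T.dist w (\<phi> b)"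
          using f[OF x ab(1)] f[OF x ab(2)] j G.dist_commute[OF x aX(1)] T.dist_commute[OF fX[OF x] ab'(1)]
          by linarith+
        moreover have "T.dist (\<phi> a) (\<phi> b) \<le> T.dist (\<phi> a) (f (p ! j)) + T.dist (f (p ! j)) (\<phi> b)"
          using T.dist_triangle ab' fX x by blast
        ultimately have "w = f (p ! j)"
          using T.between_unique[of "\<phi> a" "\<phi> b" w "f (p ! j)"] l w ab' fX[OF x] by linarith
        then show ?thesis using x by simp
      qed
      \<comment> \<open>Triangle inequalities against \<open>L\<close> place \<open>u'\<close> and
        \<open>v'\<close> between the leaves at the consecutive depths \<open>i\<close> and
        \<open>Suc i\<close>.\<close>
      have "T.dist u' (\<phi> b) \<le> Suc (T.dist v' (\<phi> b))" "T.dist (\<phi> a) v' \<le> Suc (T.dist (\<phi> a) u')"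
        using T.dist_triangle[OF e'(1,2) ab'(2)] T.dist_triangle[OF ab'(1) e'(1,2)] \<open>T.dist u' v' = 1\<close>
        by simp_all
      moreover have "T.dist (\<phi> a) (\<phi> b) \<le> T.dist (\<phi> a) u' + T.dist u' (\<phi> b)"
        "T.dist (\<phi> a) (\<phi> b) \<le> T.dist (\<phi> a) v' + T.dist v' (\<phi> b)"
        using T.dist_triangle e' ab' by blast+
      ultimately have "T.dist (\<phi> a) (\<phi> b) = T.dist (\<phi> a) u' + T.dist u' (\<phi> b)"
        "T.dist (\<phi> a) (\<phi> b) = T.dist (\<phi> a) v' + T.dist v' (\<phi> b)" "Suc i = T.dist (\<phi> a) v'"
        unfolding i_def using L by linarith+
      then have "p ! i \<in> X \<and> f (p ! i) = u'" "p ! Suc i \<in> X \<and> f (p ! Suc i) = v'"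
        using on_path[OF i_def e'(1)] on_path[OF _ e'(2)] by blast+
      moreover have "{p ! i, p ! Suc i} \<in> E"
        using p L by (auto simp: walk_between_def successively_conv_nth i_def)
      ultimately show ?thesis by blast
    qed
    \<comment> \<open>With at least two vertices, every vertex of the connected tree lies on an
      edge, which \<open>edge_lift\<close> covers.\<close>
    have "X' \<subseteq> f ` X"
    proof
      fix u assume "u \<in> X'"
      then obtain w where "{u, w} \<in> E'" using True T.ex_neighbour by metis
      then show "u \<in> f ` X" using edge_lift by blast
    qed
    then have im: "f ` X = X'" using fX by blast
    then have inj: "inj_on f X" using fin card by (simp add: eq_card_imp_inj_on)
    \<comment> \<open>Injectivity identifies the endpoints supplied by \<open>edge_lift\<close> with
      \<open>u\<close> and \<open>v\<close>.\<close>
    have edge_reflect: "{u, v} \<in> E" if "u \<in> X" "v \<in> X" "{f u, f v} \<in> E'" for u v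
      using edge_lift[OF that(3)] inj that(1,2) by (metis inj_onD)
    \<comment> \<open>A tree geodesic pulled back along the inverse of \<open>f\<close> is a walk in
      \<open>G\<close>, since tree edges come from edges of \<open>G\<close>.\<close>
    have short: "G.dist u v \<le> T.dist (f u) (f v)" if uv: "u \<in> X" "v \<in> X" for u v
    proof -
      let ?g = "inv_into X f"
      obtain p where p: "walk_between X' E' (f u) p (f v)" "length p = Suc (T.dist (f u) (f v))"
        using T.geodesic_walk fX uv by metis
      have g: "?g z \<in> X" "f (?g z) = z" if "z \<in> X'" for z
        using that im by (simp_all add: inv_into_into f_inv_into_f)
      have pX: "p \<noteq> []" "set p \<subseteq> X'" and s: "successively (\<lambda>u v. {u, v} \<in> E') p"
        and hl: "hd p = f u" "last p = f v"
        using p(1) by (simp_all add: walk_between_def)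
      have "successively (\<lambda>u v. {?g u, ?g v} \<in> E) p"
      proof (rule successively_mono[OF s])
        fix w z assume e: "{w, z} \<in> E'"
        note wz = T.edgeD(1,2)[OF e]
        show "{?g w, ?g z} \<in> E" using edge_reflect[OF g(1)[OF wz(1)] g(1)[OF wz(2)]] g(2) wz e by simp
      qed
      moreover have "set (map ?g p) \<subseteq> X" using pX(2) g(1) by auto
      ultimately have "walk_between X E u (map ?g p) v"
        using pX(1) hl uv inj by (simp add: walk_between_def successively_map hd_map last_map)
      then show ?thesis using graph_dist_le_walk p(2) by fastforce
    qed
    \<comment> \<open>An edge of \<open>G\<close> missing from the tree would be a shortcut between two boundary points.\<close>
    have edge_preserve: "{f u, f v} \<in> E'" if e: "{u, v} \<in> E" for u v
    proof -
      note e' = G.edgeD[OF e]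
      have ne: "f u \<noteq> f v" using inj e' by (meson inj_onD)
      obtain a b where ab: "a \<in> B" "b \<in> B"
        and l: "T.dist (\<phi> a) (\<phi> b) = T.dist (\<phi> a) (f u) + T.dist (f u) (f v) + T.dist (f v) (\<phi> b)"
        using ends[OF fX[OF e'(1)] fX[OF e'(2)] ne] by blast
      have aX: "a \<in> X" "b \<in> X" using ab BX by auto
      have "G.dist a b \<le> G.dist a u + G.dist u v + G.dist v b"
        using G.dist_triangle[OF aX(1) e'(1) aX(2)] G.dist_triangle[OF e'(1,2) aX(2)] by simp
      \<comment> \<open>\<open>short\<close> applies to the outer parts because \<open>f\<close>
        agrees with \<open>\<phi>\<close> on \<open>B\<close>; comparison with \<open>l\<close> then
        leaves at most 1 for the middle part.\<close>
      also have "\<dots> \<le> T.dist (\<phi> a) (f u) + 1 + T.dist (f v) (\<phi> b)"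
        using short[OF aX(1) e'(1)] short[OF e'(2) aX(2)] G.dist_edge[OF e] ab f\<phi> by simp
      finally have "T.dist (f u) (f v) \<le> 1" using l iso[OF ab] by simp
      then show ?thesis using T.dist_le_1 fX e' ne by blast
    qed
    show ?thesis
      unfolding graph_isomorphic_def
      using im inj edge_reflect edge_preserve by (intro exI[of _ f]) (auto simp: bij_betw_def)
  qed
qed

end
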